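(* For any integer $n\ge 2$, we have $$\lim_{H\to\infty}\frac{A_n^*(1,H)+A_n^*(2,H)}{2H(2H+1)^n}=1,$$ where $H$ runs through the positive integers.
   Context: The height of a polynomial $f(X)=a_0X^n+a_1X^{n-1}+\cdots+a_n$ is $H(f)=\max_{0\le j\le n}|a_j|$. If $f\in\mathbb{C}[X]$ has degree $n\ge1$ and its roots, listed with multiplicities, are labelled so that $|\alpha_1|\ge|\alpha_2|\ge\cdots\ge|\alpha_n|$, then $f$ is said to have exactly $k$ roots with maximal modulus if $|\alpha_1|=\cdots=|\alpha_k|$ and either $k=n$ or $|\alpha_k|>|\alpha_{k+1}|$. For positive integers $n,k,H$ with $k\le n$, $A_n^*(k,H)$ denotes the number of polynomials $f(X)=a_0X^n+a_1X^{n-1}+\cdots+a_n\in\mathbb{Z}[X]$ with $a_0\ne0$, $H(f)\le H$, having exactly $k$ roots with maximal modulus. *)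

theory Defs
  imports Complex_Main "HOL-Computational_Algebra.Computational_Algebra"
begin

definition height :: "int poly \<Rightarrow> int" where
  "height f = Max ((\<lambda>j. \<bar>coeff f j\<bar>) ` {0..degree f})"

text \<open>The list \<open>\<alpha>\<close> is 0-based: \<open>\<alpha> ! (i - 1)\<close> is the root usually written with index \<open>i\<close>.
  Over the complex numbers \<open>proots f\<close> has exactly \<open>degree f\<close> elements, so \<open>\<alpha> ! k\<close>
  is in range unless \<open>k = degree f\<close>, when the first disjunct already holds. The choice of labelling does not matter, since only moduli are compared.\<close>

definition has_exactly_max_modulus_roots :: "nat \<Rightarrow> complex poly \<Rightarrow> bool" where
  "has_exactly_max_modulus_roots k f \<longleftrightarrow>
     1 \<le> k \<and> k \<le> degree f \<and>
     (\<exists>\<alpha>. mset \<alpha> = proots f \<and>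
          sorted_wrt (\<lambda>x y. norm x \<ge> norm y) \<alpha> \<and>
          (\<forall>i<k. norm (\<alpha> ! i) = norm (\<alpha> ! 0)) \<and>
          (k = degree f \<or> norm (\<alpha> ! (k - 1)) > norm (\<alpha> ! k)))"

text \<open>For \<open>n \<ge> 1\<close>, \<open>degree f = n\<close> says that \<open>f\<close> is written with leading term \<open>a\<^sub>0 X\<^sup>n\<close>,
  \<open>a\<^sub>0 \<noteq> 0\<close>. The set counted is finite, so \<open>card\<close> is the true number of elements.\<close>

definition A_star :: "nat \<Rightarrow> nat \<Rightarrow> nat \<Rightarrow> nat" where
  "A_star n k H = card {f :: int poly. degree f = n \<and> height f \<le> int H \<and>
     has_exactly_max_modulus_roots k (map_poly of_int f)}"

end

theory Submission
  imports Defs "HOL-Library.FuncSet"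
begin

text \<open>
  A polynomial with neither one nor two roots of maximal modulus has three roots of equal modulus.
  A real polynomial with such roots, one of them not real, has a real factor \<open>(X - b) (X\<^sup>2 - s X + b\<^sup>2)\<close>
  or \<open>(X\<^sup>2 - s X + r) (X\<^sup>2 - u X + r)\<close>; if all three are real, two of them coincide and the first
  form appears again. Each family has one parameter fewer than its degree, so in degree \<open>n\<close> the products
  with a cofactor form a set with only \<open>n\<close> real parameters. Polynomials with \<open>\<bar>a\<^sub>0\<bar> \<le> \<epsilon> H\<close>
  contribute a proportion of about \<open>\<epsilon>\<close>. For the others all roots are bounded in terms of \<open>\<epsilon>\<close>, so
  the \<open>n\<close> parameters, scaled by \<open>H\<close>, are \<open>O(H)\<close> and the coefficients depend on them in a
  Lipschitz way; covering the parameter space by unit cells leaves \<open>O(H\<^sup>n)\<close> integer polynomials,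
  negligible against \<open>2 H (2 H + 1)\<^sup>n\<close>.
\<close>

subsection \<open>Counting integer polynomials in a parametrized family\<close>

text \<open>Passing to coefficient vectors reduces counting to the cardinality of a product. The
  vector is cut down to \<open>{..n}\<close> because \<open>PiE\<close> contains only functions that
  are \<open>undefined\<close> outside their index set.\<close>

lemma bij_betw_coeff_box:
  fixes A :: "nat \<Rightarrow> int set"
  shows "bij_betw (\<lambda>f. restrict (coeff f) {..n})
    {f. degree f \<le> n \<and> (\<forall>j\<le>n. coeff f j \<in> A j)} (PiE {..n} A)"
proof (rule bij_betw_byWitness[where f' = "\<lambda>g. Poly (map g [0..<Suc n])"])
  have co: "coeff (Poly (map g [0..<Suc n])) j = (if j \<le> n then g j else 0)" for g :: "nat \<Rightarrow> int" and j
    by (auto simp: nth_default_def nth_append simp del: upt_Suc)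
  show "\<forall>f\<in>{f. degree f \<le> n \<and> (\<forall>j\<le>n. coeff f j \<in> A j)}.
      Poly (map (restrict (coeff f) {..n}) [0..<Suc n]) = f"
    by (auto intro!: poly_eqI simp: co coeff_eq_0 simp del: upt_Suc coeff_Poly_eq)
  show "\<forall>g\<in>PiE {..n} A. restrict (coeff (Poly (map g [0..<Suc n]))) {..n} = g"
    by (auto simp: co fun_eq_iff restrict_def PiE_def extensional_def simp del: upt_Suc coeff_Poly_eq)
  show "(\<lambda>f. restrict (coeff f) {..n}) ` {f. degree f \<le> n \<and> (\<forall>j\<le>n. coeff f j \<in> A j)} \<subseteq> PiE {..n} A"
    by (rule image_subsetI, simp only: restrict_PiE_iff) simp
  show "(\<lambda>g. Poly (map g [0..<Suc n])) ` PiE {..n} A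
      \<subseteq> {f. degree f \<le> n \<and> (\<forall>j\<le>n. coeff f j \<in> A j)}"
    by (auto simp: co simp del: upt_Suc coeff_Poly_eq intro!: degree_le)
qed

lemma card_coeff_box:
  "card {f. degree f \<le> n \<and> (\<forall>j\<le>n. coeff f j \<in> A j)} = (\<Prod>j\<le>n. card (A j :: int set))"
  using bij_betw_same_card[OF bij_betw_coeff_box[of n A]] by (simp add: card_PiE)

lemma finite_coeff_box:
  assumes "\<And>j. j \<le> n \<Longrightarrow> finite (A j :: int set)"
  shows "finite {f. degree f \<le> n \<and> (\<forall>j\<le>n. coeff f j \<in> A j)}"
  using bij_betw_finite[OF bij_betw_coeff_box[of n A]] assms by (auto intro!: finite_PiE)

lemma card_le_fibres:
  assumes "finite T" "\<Phi> ` S \<subseteq> T" "\<And>t. t \<in> T \<Longrightarrow> card {x \<in> S. \<Phi> x = t} \<le> M"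
  shows "card S \<le> card T * M"
proof -
  have "S = (\<Union>t\<in>T. {x \<in> S. \<Phi> x = t})" using assms(2) by auto
  hence "card S \<le> (\<Sum>t\<in>T. card {x \<in> S. \<Phi> x = t})" using card_UN_le[OF assms(1)] by metis
  also have "\<dots> \<le> (\<Sum>t\<in>T. M)" by (intro sum_mono assms(3))
  finally show ?thesis by simp
qed

text \<open>The cells of the parameter space are the fibres of the coordinatewise floor.\<close>

lemma card_int_polys_le_cells:
  fixes v :: "int poly \<Rightarrow> nat \<Rightarrow> real"
  assumes deg: "\<And>f. f \<in> S \<Longrightarrow> degree f \<le> n"
  assumes bd: "\<And>f i. f \<in> S \<Longrightarrow> i < d \<Longrightarrow> \<bar>v f i\<bar> \<le> real B"
  assumes near: "\<And>f f' j. f \<in> S \<Longrightarrow> f' \<in> S \<Longrightarrow> (\<And>i. i < d \<Longrightarrow> \<bar>v f i - v f' i\<bar> \<le> 1) \<Longrightarrow>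
     j \<le> n \<Longrightarrow> \<bar>coeff f j - coeff f' j\<bar> \<le> int D"
  shows "card S \<le> (2 * B + 1) ^ d * (2 * D + 1) ^ Suc n"
proof -
  let ?T = "PiE {..<d} (\<lambda>_. {- int B..int B})"
  let ?\<Phi> = "\<lambda>f. restrict (\<lambda>i. \<lfloor>v f i\<rfloor>) {..<d}"
  let ?X = "{f. degree f \<le> n \<and> (\<forall>j\<le>n. coeff f j \<in> {- int D..int D})}"
  have "card S \<le> card ?T * (2 * D + 1) ^ Suc n"
  proof (rule card_le_fibres)
    show "finite ?T" by (intro finite_PiE) auto
    show "?\<Phi> ` S \<subseteq> ?T"
    proof -
      have "- int B \<le> \<lfloor>v f i\<rfloor> \<and> \<lfloor>v f i\<rfloor> \<le> int B" if "f \<in> S" "i < d" for f i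
        using bd[OF that] by linarith
      thus ?thesis by (intro image_subsetI, simp only: restrict_PiE_iff) simp
    qed
    fix t assume "t \<in> ?T"
    show "card {f \<in> S. ?\<Phi> f = t} \<le> (2 * D + 1) ^ Suc n"
    proof (cases "{f \<in> S. ?\<Phi> f = t} = {}")
      case True
      show ?thesis unfolding True by simp
    next
      case False
      then obtain f0 where f0: "f0 \<in> S" "?\<Phi> f0 = t" by auto
      \<comment> \<open>Members of one cell have nearby coefficients, so translation by a fixed
        member \<open>f0\<close>, which is injective, carries the fibre into a box with
        \<open>2 * D + 1\<close> values per coefficient.\<close>
      have "(\<lambda>f. f - f0) ` {f \<in> S. ?\<Phi> f = t} \<subseteq> ?X"
      proof safe
        fix f assume f: "f \<in> S" "t = ?\<Phi> f"
        show "degree (f - f0) \<le> n" using deg f(1) f0(1) by (intro degree_diff_le) auto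
        fix j assume j: "j \<le> n"
        have "\<bar>coeff f j - coeff f0 j\<bar> \<le> int D"
        proof (rule near[OF f(1) f0(1) _ j])
          fix i assume "i < d"
          hence "\<lfloor>v f i\<rfloor> = \<lfloor>v f0 i\<rfloor>" using f(2) f0(2) by (metis lessThan_iff restrict_apply')
          thus "\<bar>v f i - v f0 i\<bar> \<le> 1" by linarith
        qed
        thus "coeff (f - f0) j \<in> {- int D..int D}" by auto
      qed
      hence "card ((\<lambda>f. f - f0) ` {f \<in> S. ?\<Phi> f = t}) \<le> card ?X"
        by (intro card_mono finite_coeff_box) auto
      moreover have "card ?X = (2 * D + 1) ^ Suc n"
      proof -
        have "nat (2 * int D + 1) = 2 * D + 1" by linarith
        thus ?thesis unfolding card_coeff_box by simp
      qed
      ultimately show ?thesis by (simp only: card_image inj_on_diff_right)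
    qed
  qed
  moreover have "nat (2 * int B + 1) = 2 * B + 1" by linarith
  ultimately show ?thesis by (simp add: card_PiE)
qed

section \<open>Lipschitz dependence of coefficients on parameters\<close>

definition box :: "nat \<Rightarrow> real \<Rightarrow> (nat \<Rightarrow> real) set" where
  "box d B = {\<theta>. \<forall>i<d. \<bar>\<theta> i\<bar> \<le> B}"

text \<open>One constant \<open>M\<close> bounds both the values and the variation relative to the
  sup distance of the first \<open>d\<close> coordinates. Having both bounds makes the class closed
  under products.\<close>

definition lip_on_box :: "nat \<Rightarrow> real \<Rightarrow> ((nat \<Rightarrow> real) \<Rightarrow> real) \<Rightarrow> real \<Rightarrow> bool" where
  "lip_on_box d B F M \<longleftrightarrow> 0 \<le> M \<and> (\<forall>\<theta>\<in>box d B. \<bar>F \<theta>\<bar> \<le> M) \<and>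
     (\<forall>\<theta>\<in>box d B. \<forall>\<theta>'\<in>box d B. \<forall>\<delta>\<ge>0. (\<forall>i<d. \<bar>\<theta> i - \<theta>' i\<bar> \<le> \<delta>) \<longrightarrow> \<bar>F \<theta> - F \<theta>'\<bar> \<le> M * \<delta>)"

lemma lip_on_box_const: "lip_on_box d B (\<lambda>_. c) \<bar>c\<bar>"
  by (auto simp: lip_on_box_def)

text \<open>The values are bounded by \<open>B\<close> and the Lipschitz constant is 1; the maximum
  serves for both.\<close>

lemma lip_on_box_proj:
  assumes i: "i < d"
  shows "lip_on_box d B (\<lambda>\<theta>. \<theta> i) (max B 1)"
  unfolding lip_on_box_def
proof (intro conjI ballI allI impI)
  show "\<bar>\<theta> i\<bar> \<le> max B 1" if "\<theta> \<in> box d B" for \<theta>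
    using that i by (auto simp: box_def intro: max.coboundedI1)
  show "\<bar>\<theta> i - \<theta>' i\<bar> \<le> max B 1 * \<delta>" if "0 \<le> \<delta>" "\<forall>i<d. \<bar>\<theta> i - \<theta>' i\<bar> \<le> \<delta>" for \<theta> \<theta>' :: "nat \<Rightarrow> real" and \<delta>
  proof -
    have "\<bar>\<theta> i - \<theta>' i\<bar> \<le> 1 * \<delta>" using that(2) i by simp
    also have "\<dots> \<le> max B 1 * \<delta>" using that(1) by (intro mult_right_mono) auto
    finally show ?thesis .
  qed
qed auto

lemma lip_on_box_mono: "lip_on_box d B F M \<Longrightarrow> M \<le> M' \<Longrightarrow> lip_on_box d B F M'"
  unfolding lip_on_box_def by (meson mult_right_mono order_trans)

lemma lip_on_box_add:
  assumes "lip_on_box d B F M" "lip_on_box d B G N"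
  shows "lip_on_box d B (\<lambda>\<theta>. F \<theta> + G \<theta>) (M + N)"
  unfolding lip_on_box_def distrib_right
proof (intro conjI ballI allI impI)
  show "0 \<le> M + N" using assms by (simp add: lip_on_box_def)
  fix \<theta> assume \<theta>: "\<theta> \<in> box d B"
  hence "\<bar>F \<theta>\<bar> \<le> M" "\<bar>G \<theta>\<bar> \<le> N" using assms by (auto simp: lip_on_box_def)
  thus "\<bar>F \<theta> + G \<theta>\<bar> \<le> M + N" by linarith
  fix \<theta>' \<delta> assume "\<theta>' \<in> box d B" "(0::real) \<le> \<delta>" "\<forall>i<d. \<bar>\<theta> i - \<theta>' i\<bar> \<le> \<delta>"
  hence "\<bar>F \<theta> - F \<theta>'\<bar> \<le> M * \<delta>" "\<bar>G \<theta> - G \<theta>'\<bar> \<le> N * \<delta>"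
    using assms \<theta> by (auto simp: lip_on_box_def)
  thus "\<bar>F \<theta> + G \<theta> - (F \<theta>' + G \<theta>')\<bar> \<le> M * \<delta> + N * \<delta>" by linarith
qed

text \<open>After insertion of the mixed term \<open>F \<theta>' * G \<theta>\<close>, each of the
  two differences costs at most \<open>M * N * \<delta>\<close>, whence the factor 2.\<close>

lemma lip_on_box_mult:
  assumes F: "lip_on_box d B F M" and G: "lip_on_box d B G N"
  shows "lip_on_box d B (\<lambda>\<theta>. F \<theta> * G \<theta>) (2 * M * N)"
  unfolding lip_on_box_def
proof (intro conjI ballI allI impI)
  have nn: "0 \<le> M" "0 \<le> N" using assms by (auto simp: lip_on_box_def)
  thus "0 \<le> 2 * M * N" by simp
  fix \<theta> assume \<theta>: "\<theta> \<in> box d B"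
  hence b: "\<bar>F \<theta>\<bar> \<le> M" "\<bar>G \<theta>\<bar> \<le> N" using assms by (auto simp: lip_on_box_def)
  hence "\<bar>F \<theta>\<bar> * \<bar>G \<theta>\<bar> \<le> M * N" by (intro mult_mono) (use nn in auto)
  moreover have "0 \<le> M * N" using nn by simp
  ultimately show "\<bar>F \<theta> * G \<theta>\<bar> \<le> 2 * M * N" by (simp add: abs_mult)
  fix \<theta>' \<delta> assume \<theta>': "\<theta>' \<in> box d B" and \<delta>: "(0::real) \<le> \<delta>" "\<forall>i<d. \<bar>\<theta> i - \<theta>' i\<bar> \<le> \<delta>"
  have b': "\<bar>F \<theta>'\<bar> \<le> M" using F \<theta>' by (auto simp: lip_on_box_def)
  have l: "\<bar>F \<theta> - F \<theta>'\<bar> \<le> M * \<delta>" "\<bar>G \<theta> - G \<theta>'\<bar> \<le> N * \<delta>"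
    using F G \<theta> \<theta>' \<delta> by (auto simp: lip_on_box_def)
  have "F \<theta> * G \<theta> - F \<theta>' * G \<theta>' = (F \<theta> - F \<theta>') * G \<theta> + F \<theta>' * (G \<theta> - G \<theta>')"
    by (simp add: algebra_simps)
  hence "\<bar>F \<theta> * G \<theta> - F \<theta>' * G \<theta>'\<bar> \<le> \<bar>F \<theta> - F \<theta>'\<bar> * \<bar>G \<theta>\<bar> + \<bar>F \<theta>'\<bar> * \<bar>G \<theta> - G \<theta>'\<bar>"
    by (metis abs_mult abs_triangle_ineq)
  also have "\<dots> \<le> (M * \<delta>) * N + M * (N * \<delta>)"
    by (intro add_mono mult_mono l b b') (use nn \<delta> in auto)
  finally show "\<bar>F \<theta> * G \<theta> - F \<theta>' * G \<theta>'\<bar> \<le> 2 * M * N * \<delta>" by (simp add: algebra_simps)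
qed

definition lip_poly :: "nat \<Rightarrow> real \<Rightarrow> ((nat \<Rightarrow> real) \<Rightarrow> real poly) \<Rightarrow> bool" where
  "lip_poly d B P \<longleftrightarrow> (\<forall>j. \<exists>M. lip_on_box d B (\<lambda>\<theta>. coeff (P \<theta>) j) M)"

lemma lip_poly_const: "lip_poly d B (\<lambda>_. p)"
  unfolding lip_poly_def using lip_on_box_const by blast

lemma lip_poly_pCons:
  assumes "lip_on_box d B a M" "lip_poly d B P"
  shows "lip_poly d B (\<lambda>\<theta>. pCons (a \<theta>) (P \<theta>))"
  unfolding lip_poly_def
proof
  fix j show "\<exists>M. lip_on_box d B (\<lambda>\<theta>. coeff (pCons (a \<theta>) (P \<theta>)) j) M"
    using assms by (cases j) (auto simp: lip_poly_def)
qed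

lemma lip_on_box_sum:
  assumes "finite I" "\<And>i. i \<in> I \<Longrightarrow> \<exists>M. lip_on_box d B (F i) M"
  shows "\<exists>M. lip_on_box d B (\<lambda>\<theta>. \<Sum>i\<in>I. F i \<theta>) M"
  using assms
proof (induction I rule: finite_induct)
  case empty
  show ?case using lip_on_box_const[of d B 0] by auto
next
  case (insert i I)
  obtain M N where "lip_on_box d B (F i) M" "lip_on_box d B (\<lambda>\<theta>. \<Sum>i\<in>I. F i \<theta>) N"
    using insert by blast
  from lip_on_box_add[OF this] show ?case using insert.hyps by auto
qed

lemma lip_poly_mult:
  assumes "lip_poly d B P" "lip_poly d B Q"
  shows "lip_poly d B (\<lambda>\<theta>. P \<theta> * Q \<theta>)"
  unfolding lip_poly_def coeff_mult
proof
  fix j show "\<exists>M. lip_on_box d B (\<lambda>\<theta>. \<Sum>i\<le>j. coeff (P \<theta>) i * coeff (Q \<theta>) (j - i)) M"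
  proof (rule lip_on_box_sum)
    fix i
    obtain M N where "lip_on_box d B (\<lambda>\<theta>. coeff (P \<theta>) i) M"
        "lip_on_box d B (\<lambda>\<theta>. coeff (Q \<theta>) (j - i)) N"
      using assms unfolding lip_poly_def by blast
    from lip_on_box_mult[OF this]
    show "\<exists>M. lip_on_box d B (\<lambda>\<theta>. coeff (P \<theta>) i * coeff (Q \<theta>) (j - i)) M" ..
  qed simp
qed

text \<open>Only finitely many coefficients are concerned, so the sum of their constants, rounded
  up, serves for all of them.\<close>

lemma lip_poly_uniform:
  assumes "lip_poly d B P"
  obtains M :: nat where "\<And>j. j \<le> n \<Longrightarrow> lip_on_box d B (\<lambda>\<theta>. coeff (P \<theta>) j) (real M)"
proof -
  obtain M where M: "\<And>j. lip_on_box d B (\<lambda>\<theta>. coeff (P \<theta>) j) (M j)"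
    using assms unfolding lip_poly_def by metis
  have nn: "0 \<le> M j" for j using M[of j] by (simp add: lip_on_box_def)
  have "lip_on_box d B (\<lambda>\<theta>. coeff (P \<theta>) j) (real (nat \<lceil>\<Sum>j\<le>n. M j\<rceil>))" if "j \<le> n" for j
  proof (rule lip_on_box_mono[OF M])
    have "M j \<le> (\<Sum>j\<le>n. M j)" using that nn by (intro member_le_sum) auto
    thus "M j \<le> real (nat \<lceil>\<Sum>j\<le>n. M j\<rceil>)" by linarith
  qed
  thus ?thesis by (rule that)
qed

section \<open>Counting multiples of a parametrized polynomial\<close>

text \<open>The degree bound on \<open>g\<close> fits a factor \<open>P \<theta>\<close> of degree
  \<open>d + 1\<close>. For \<open>d \<ge> n\<close> the truncated subtraction makes the predicate
  false.\<close>

definition has_factor_in ::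
  "nat \<Rightarrow> nat \<Rightarrow> nat \<Rightarrow> nat \<Rightarrow> ((nat \<Rightarrow> real) \<Rightarrow> real poly) \<Rightarrow> int poly \<Rightarrow> bool" where
  "has_factor_in n d B M P f \<longleftrightarrow> degree f \<le> n \<and>
     (\<exists>\<theta>\<in>box d (real B). \<exists>g. degree g < n - d \<and> (\<forall>j. \<bar>coeff g j\<bar> \<le> real M) \<and>
        map_poly of_int f = P \<theta> * g)"

text \<open>The \<open>d\<close> parameters of \<open>P\<close>, scaled by \<open>H\<close>, and the \<open>n - d\<close> coefficients of \<open>g\<close>
  are \<open>n\<close> real numbers of size \<open>O(H)\<close>; this is one fewer than the \<open>n + 1\<close> coefficients of \<open>f\<close>.\<close>

lemma card_parametrized_factor:
  fixes P :: "(nat \<Rightarrow> real) \<Rightarrow> real poly"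
  assumes P: "lip_poly d (real B) P"
  shows "\<exists>K. \<forall>H\<ge>1. \<forall>S. (\<forall>f\<in>S. has_factor_in n d B (C * H) P f) \<longrightarrow> card S \<le> K * H ^ n"
proof -
  obtain M :: nat where M: "\<And>j. j \<le> n \<Longrightarrow> lip_on_box d (real B) (\<lambda>\<theta>. coeff (P \<theta>) j) (real M)"
    using lip_poly_uniform[OF P, of n] by blast
  \<comment> \<open>Within a unit cell \<open>\<theta>\<close> varies by at most
    \<open>1 / H\<close>, so a coefficient of \<open>P \<theta>\<close> varies by at most
    \<open>M / H\<close>; multiplied by a coefficient of \<open>g\<close> of size at most
    \<open>C * H\<close> this costs \<open>M * C\<close>. The variation of \<open>g\<close> by 1
    costs another \<open>M\<close>, and a coefficient of the product has at most
    \<open>Suc n\<close> summands.\<close>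
  define D where "D = Suc n * (M * C + M)"
  define K where "K = (2 * (B + C) + 1) ^ n * (2 * D + 1) ^ Suc n"
  have "card S \<le> K * H ^ n" if H: "H \<ge> 1" and S: "\<forall>f\<in>S. has_factor_in n d B (C * H) P f"
    for H :: nat and S
  proof -
    define ok where "ok f \<theta> g \<longleftrightarrow> \<theta> \<in> box d (real B) \<and> degree g < n - d \<and>
      (\<forall>j. \<bar>coeff g j\<bar> \<le> real (C * H)) \<and> map_poly of_int f = P \<theta> * g"
      for f :: "int poly" and \<theta> g
    have "\<forall>f\<in>S. \<exists>\<theta> g. ok f \<theta> g"
      using S unfolding ok_def has_factor_in_def by blast
    from bchoice[OF this] obtain \<theta> where "\<forall>f\<in>S. \<exists>g. ok f (\<theta> f) g" ..
    from bchoice[OF this] obtain g where "\<forall>f\<in>S. ok f (\<theta> f) (g f)" ..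
    hence tg: "\<theta> f \<in> box d (real B)" "degree (g f) < n - d" "\<bar>coeff (g f) j\<bar> \<le> real (C * H)"
      "map_poly of_int f = P (\<theta> f) * g f" if "f \<in> S" for f j
      using that unfolding ok_def by blast+
    \<comment> \<open>The scaling by \<open>H\<close> brings all \<open>n\<close> coordinates to
      size at most \<open>(B + C) * H\<close>, so that unit cells suit both kinds of
      parameter.\<close>
    define v where "v f i = (if i < d then real H * \<theta> f i else coeff (g f) (i - d))" for f i
    have "card S \<le> (2 * ((B + C) * H) + 1) ^ n * (2 * D + 1) ^ Suc n"
    proof (rule card_int_polys_le_cells)
      fix f i assume f: "f \<in> S" and i: "i < n"
      show "\<bar>v f i\<bar> \<le> real ((B + C) * H)"
      proof (cases "i < d")
        case True
        hence "\<bar>\<theta> f i\<bar> \<le> real B" using tg(1)[OF f] by (auto simp: box_def)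
        hence "real H * \<bar>\<theta> f i\<bar> \<le> real H * real B" by (intro mult_left_mono) auto
        thus ?thesis using True by (simp add: v_def abs_mult algebra_simps add_increasing2)
      next
        case False
        thus ?thesis using tg(3)[OF f, of "i - d"] by (simp add: v_def algebra_simps add_increasing)
      qed
    next
      fix f f' :: "int poly" and j
      assume f: "f \<in> S" "f' \<in> S" and vi: "\<And>i. i < n \<Longrightarrow> \<bar>v f i - v f' i\<bar> \<le> 1" and j: "j \<le> n"
      have d: "d < n" using tg(2)[OF f(1)] by simp
      have th: "\<bar>\<theta> f i - \<theta> f' i\<bar> \<le> 1 / real H" if "i < d" for i
      proof -
        have "\<bar>real H * \<theta> f i - real H * \<theta> f' i\<bar> \<le> 1" using vi[of i] that d by (simp add: v_def)
        hence "real H * \<bar>\<theta> f i - \<theta> f' i\<bar> \<le> 1"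
          by (simp add: right_diff_distrib[symmetric] abs_mult)
        thus ?thesis using H by (simp add: pos_le_divide_eq mult.commute)
      qed
      have gd: "\<bar>coeff (g f) i - coeff (g f') i\<bar> \<le> 1" for i
      proof (cases "i < n - d")
        case True
        thus ?thesis using vi[of "i + d"] by (simp add: v_def)
      next
        case False
        thus ?thesis using tg(2)[OF f(1)] tg(2)[OF f(2)] by (simp add: coeff_eq_0)
      qed
      have summand: "\<bar>coeff (P (\<theta> f)) i * coeff (g f) (j - i) - coeff (P (\<theta> f')) i * coeff (g f') (j - i)\<bar>
           \<le> real (M * C + M)" if "i \<le> j" for i
      proof -
        let ?p = "coeff (P (\<theta> f)) i" and ?p' = "coeff (P (\<theta> f')) i"
        let ?g = "coeff (g f) (j - i)" and ?g' = "coeff (g f') (j - i)"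
        have L: "lip_on_box d (real B) (\<lambda>\<theta>. coeff (P \<theta>) i) (real M)" using M that j by simp
        have 1: "\<bar>?p - ?p'\<bar> \<le> real M * (1 / real H)"
        proof -
          have "0 \<le> 1 / real H" by simp
          thus ?thesis using L th tg(1)[OF f(1)] tg(1)[OF f(2)] unfolding lip_on_box_def by blast
        qed
        have 2: "\<bar>?p'\<bar> \<le> real M" using L tg(1)[OF f(2)] by (auto simp: lip_on_box_def)
        have "?p * ?g - ?p' * ?g' = (?p - ?p') * ?g + ?p' * (?g - ?g')" by (simp add: algebra_simps)
        hence "\<bar>?p * ?g - ?p' * ?g'\<bar> \<le> \<bar>?p - ?p'\<bar> * \<bar>?g\<bar> + \<bar>?p'\<bar> * \<bar>?g - ?g'\<bar>"
          by (metis abs_mult abs_triangle_ineq)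
        also have "\<dots> \<le> (real M * (1 / real H)) * real (C * H) + real M * 1"
          by (intro add_mono mult_mono 1 2 gd tg(3)[OF f(1)]) auto
        also have "\<dots> = real (M * C + M)" using H by simp
        finally show ?thesis .
      qed
      have co: "real_of_int (coeff f j) = (\<Sum>i\<le>j. coeff (P (\<theta> f)) i * coeff (g f) (j - i))"
        if "f \<in> S" for f
        using arg_cong[OF tg(4)[OF that], of "\<lambda>p. coeff p j"] by (simp add: coeff_map_poly coeff_mult)
      have "\<bar>real_of_int (coeff f j) - real_of_int (coeff f' j)\<bar> \<le>
         (\<Sum>i\<le>j. \<bar>coeff (P (\<theta> f)) i * coeff (g f) (j - i) - coeff (P (\<theta> f')) i * coeff (g f') (j - i)\<bar>)"
        unfolding co[OF f(1)] co[OF f(2)] sum_subtractf[symmetric] by (rule sum_abs)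
      also have "\<dots> \<le> (\<Sum>i\<le>j. real (M * C + M))" by (intro sum_mono summand) auto
      also have "\<dots> = real (Suc j * (M * C + M))" by (simp add: algebra_simps)
      also have "\<dots> \<le> real D" unfolding D_def using j by (intro of_nat_mono mult_right_mono) auto
      finally show "\<bar>coeff f j - coeff f' j\<bar> \<le> int D" by linarith
    qed (use S in \<open>auto simp: has_factor_in_def\<close>)
    \<comment> \<open>Since \<open>H \<ge> 1\<close>, the summand 1 is absorbed into a multiple of
      \<open>H\<close>, and the number of cells becomes a constant times
      \<open>H ^ n\<close>.\<close>
    also have "\<dots> \<le> ((2 * (B + C) + 1) * H) ^ n * (2 * D + 1) ^ Suc n"
      using H by (intro mult_right_mono power_mono) (auto simp: algebra_simps)
    also have "\<dots> = K * H ^ n" unfolding K_def power_mult_distrib by (simp only: mult_ac)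
    finally show ?thesis .
  qed
  thus ?thesis by blast
qed

subsection \<open>Real factors forced by three roots of equal modulus\<close>

abbreviation cpoly :: "real poly \<Rightarrow> complex poly" where
  "cpoly \<equiv> map_poly complex_of_real"

lemma cpoly_mult: "cpoly (p * q) = cpoly p * cpoly q"
  by (rule poly_eqI) (simp add: coeff_map_poly coeff_mult)

lemma cpoly_add: "cpoly (p + q) = cpoly p + cpoly q"
  by (rule poly_eqI) (simp add: coeff_map_poly)

lemma cpoly_eq_0_iff [simp]: "cpoly p = 0 \<longleftrightarrow> p = 0"
  by (simp add: poly_eq_iff coeff_map_poly)

lemma degree_cpoly [simp]: "degree (cpoly p) = degree p"
  by (simp add: degree_map_poly)

lemma poly_cpoly_of_real: "poly (cpoly p) (complex_of_real x) = complex_of_real (poly p x)"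
  by (induction p) (simp_all add: map_poly_pCons)

lemma real_linear_factor:
  assumes "poly (cpoly f) a = 0" "Im a = 0"
  obtains g where "f = [:- Re a, 1:] * g"
proof -
  have "a = complex_of_real (Re a)" using assms(2) by (simp add: complex_eq_iff)
  hence "poly f (Re a) = 0" using assms(1) poly_cpoly_of_real[of f "Re a"] by simp
  thus ?thesis using that by (auto simp: poly_eq_0_iff_dvd elim!: dvdE)
qed

lemma cpoly_quadratic:
  "cpoly [:(cmod a)\<^sup>2, - (2 * Re a), 1:] = [:- a, 1:] * [:- cnj a, 1:]"
  by (simp add: map_poly_pCons complex_eq_iff cmod_power2) (simp add: power2_eq_square)

text \<open>The remainder modulo the quadratic is \<open>[:x, y:]\<close> with real \<open>x\<close>
  and \<open>y\<close>, and it vanishes at \<open>a\<close>. As \<open>a\<close> is not real, the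
  imaginary part gives \<open>y = 0\<close>, and then \<open>x = 0\<close>.\<close>

lemma real_quadratic_factor:
  assumes root: "poly (cpoly f) a = 0" and im: "Im a \<noteq> 0"
  obtains g where "f = [:(cmod a)\<^sup>2, - (2 * Re a), 1:] * g"
proof -
  define q where "q = [:(cmod a)\<^sup>2, - (2 * Re a), 1:]"
  have "degree (f mod q) < degree q"
    using degree_mod_less[of q f] by (auto simp: q_def)
  hence "degree (f mod q) \<le> 1" by (simp add: q_def)
  then obtain x y where r: "f mod q = [:x, y:]"
    by (metis One_nat_def degree1_coeffs degree_eq_zeroE le_Suc_eq le_zero_eq pCons_0_0)
  have "f = q * (f div q) + f mod q" by simp
  hence "cpoly f = cpoly q * cpoly (f div q) + cpoly [:x, y:]"
    unfolding r by (metis cpoly_add cpoly_mult)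
  hence "complex_of_real x + a * complex_of_real y = 0"
    using root unfolding q_def cpoly_quadratic
    by (simp add: map_poly_pCons del: mult_pCons_left mult_pCons_right)
  hence "y = 0" "x = 0" using im by (auto simp: complex_eq_iff)
  hence "f = q * (f div q)" using r by (metis add.right_neutral mult_div_mod_eq pCons_0_0)
  thus ?thesis using that by (simp add: q_def)
qed

section \<open>The two families and three roots of equal modulus\<close>

text \<open>A real root \<open>b\<close> and a conjugate pair of the same modulus: the pair has
  product \<open>b\<^sup>2\<close>, so two parameters suffice in degree three.\<close>

definition cubic_family :: "(nat \<Rightarrow> real) \<Rightarrow> real poly" where
  "cubic_family \<theta> = [:- \<theta> 0, 1:] * [:(\<theta> 0)\<^sup>2, - \<theta> 1, 1:]"

text \<open>Two conjugate pairs of equal modulus share the squared modulus \<open>\<theta> 0\<close>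
  as constant term, which leaves three parameters in degree four.\<close>

definition quartic_family :: "(nat \<Rightarrow> real) \<Rightarrow> real poly" where
  "quartic_family \<theta> = [:\<theta> 0, - \<theta> 1, 1:] * [:\<theta> 0, - \<theta> 2, 1:]"

lemma degree_cubic_family: "degree (cubic_family \<theta>) = 3"
  unfolding cubic_family_def by (subst degree_mult_eq) auto

lemma degree_quartic_family: "degree (quartic_family \<theta>) = 4"
  unfolding quartic_family_def by (subst degree_mult_eq) auto

lemma monic_families:
  "lead_coeff (cubic_family \<theta>) = 1" "lead_coeff (quartic_family \<theta>) = 1"
  unfolding cubic_family_def quartic_family_def lead_coeff_mult by simp_all

lemma lip_families: "lip_poly 2 B cubic_family" "lip_poly 3 B quartic_family"
proof -
  have neg: "lip_on_box d B (\<lambda>\<theta>. - \<theta> i) (2 * \<bar>- 1\<bar> * max B 1)" if "i < d" for i d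
    using lip_on_box_mult[OF lip_on_box_const lip_on_box_proj, OF that, of B "- 1"] by simp
  have sq: "lip_on_box d B (\<lambda>\<theta>. (\<theta> i)\<^sup>2) (2 * max B 1 * max B 1)" if "i < d" for i d
    using lip_on_box_mult[OF lip_on_box_proj lip_on_box_proj, OF that that]
    by (simp add: power2_eq_square)
  show "lip_poly 2 B cubic_family" unfolding cubic_family_def
    by (intro lip_poly_mult lip_poly_pCons[OF neg] lip_poly_pCons[OF sq] lip_poly_const) auto
  show "lip_poly 3 B quartic_family" unfolding quartic_family_def
    by (intro lip_poly_mult lip_poly_pCons[OF neg] lip_poly_pCons[OF lip_on_box_proj]
        lip_poly_const) auto
qed

text \<open>The side \<open>2 * R + R\<^sup>2\<close> accommodates at once a root, a sum of two
  roots and a product of two roots of modulus at most \<open>R\<close>.\<close>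

definition in_families :: "real \<Rightarrow> real poly \<Rightarrow> bool" where
  "in_families R f \<longleftrightarrow>
     (\<exists>\<theta>\<in>box 2 (2 * R + R\<^sup>2). \<exists>g. f = cubic_family \<theta> * g) \<or>
     (\<exists>\<theta>\<in>box 3 (2 * R + R\<^sup>2). \<exists>g. f = quartic_family \<theta> * g)"

lemma in_families_cubicI:
  assumes "\<bar>b\<bar> \<le> R" "\<bar>s\<bar> \<le> 2 * R" "f = [:- b, 1:] * [:b\<^sup>2, - s, 1:] * g"
  shows "in_families R f"
proof -
  let ?\<theta> = "\<lambda>i::nat. if i = 0 then b else s"
  have "\<bar>b\<bar> \<le> 2 * R + R\<^sup>2" "\<bar>s\<bar> \<le> 2 * R + R\<^sup>2"
    using assms(1,2) zero_le_power2[of R] by linarith+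
  hence "?\<theta> \<in> box 2 (2 * R + R\<^sup>2)" unfolding box_def by auto
  moreover have "f = cubic_family ?\<theta> * g" using assms(3) by (simp add: cubic_family_def)
  ultimately show ?thesis unfolding in_families_def by blast
qed

lemma in_families_quarticI:
  assumes "\<bar>r\<bar> \<le> R\<^sup>2" "\<bar>s\<bar> \<le> 2 * R" "\<bar>u\<bar> \<le> 2 * R" "f = [:r, - s, 1:] * [:r, - u, 1:] * g"
  shows "in_families R f"
proof -
  let ?\<theta> = "\<lambda>i::nat. if i = 0 then r else if i = 1 then s else u"
  have "\<bar>r\<bar> \<le> 2 * R + R\<^sup>2" "\<bar>s\<bar> \<le> 2 * R + R\<^sup>2" "\<bar>u\<bar> \<le> 2 * R + R\<^sup>2"
    using assms(1,2,3) zero_le_power2[of R] by linarith+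
  hence "?\<theta> \<in> box 3 (2 * R + R\<^sup>2)" unfolding box_def by auto
  moreover have "f = quartic_family ?\<theta> * g" using assms(4) by (simp add: quartic_family_def)
  ultimately show ?thesis unfolding in_families_def by blast
qed

lemma root_if_subset_proots:
  assumes "add_mset a X \<subseteq># proots F" "F \<noteq> 0"
  shows "poly F a = 0"
proof -
  have "a \<in># proots F" using assms(1) by (simp add: insert_subset_eq_iff)
  thus ?thesis using assms(2) by simp
qed

text \<open>The conjugate pair of \<open>a\<close> is split off. At least one of \<open>b\<close>
  and \<open>c\<close> survives as a root of the cofactor; it gives the cubic family if it is real
  and the quartic family otherwise.\<close>

lemma equimodular_roots_nonreal:
  assumes f: "f \<noteq> 0" and roots: "{#a, b, c#} \<subseteq># proots (cpoly f)"
    and mod: "cmod b = cmod a" "cmod c = cmod a" and R: "cmod a \<le> R" and im: "Im a \<noteq> 0"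
  shows "in_families R f"
proof -
  have abs_Re: "\<bar>2 * Re z\<bar> \<le> 2 * R" if "cmod z = cmod a" for z
    using abs_Re_le_cmod[of z] that R by simp
  have sq: "\<bar>(cmod a)\<^sup>2\<bar> \<le> R\<^sup>2" using R by (simp add: power_mono)
  have "poly (cpoly f) a = 0"
    using root_if_subset_proots[OF roots] f by simp
  from real_quadratic_factor[OF this im] obtain f1
    where f1: "f = [:(cmod a)\<^sup>2, - (2 * Re a), 1:] * f1" .
  have f1_0: "f1 \<noteq> 0" using f f1 by auto
  have "cpoly f = [:- a, 1:] * ([:- cnj a, 1:] * cpoly f1)"
    unfolding f1 by (simp only: cpoly_mult cpoly_quadratic mult.assoc)
  hence "proots (cpoly f) = {#a, cnj a#} + proots (cpoly f1)"
    using f1_0 by (simp add: proots_mult del: mult_pCons_left)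
  hence "{#b, c#} \<subseteq># {#cnj a#} + proots (cpoly f1)"
    using roots by (simp add: add_mset_commute)
  \<comment> \<open>The root \<open>cnj a\<close> accounts for at most one of \<open>b\<close> and
    \<open>c\<close>, counted with multiplicity; whatever remains is a root of
    \<open>f1\<close>.\<close>
  hence sub: "{#b, c#} - {#cnj a#} \<subseteq># proots (cpoly f1)"
    by (simp add: subset_eq_diff_conv add.commute)
  have "size {#b, c#} \<le> size {#cnj a#}" if "{#b, c#} - {#cnj a#} = {#}"
    using that by (intro size_mset_mono) (simp only: Diff_eq_empty_iff_mset)
  hence "{#b, c#} - {#cnj a#} \<noteq> {#}" by auto
  then obtain z where z: "z \<in># {#b, c#} - {#cnj a#}" by blast
  hence "z \<in># {#b, c#}" by (rule in_diffD)
  hence zmod: "cmod z = cmod a" using mod by auto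
  have root: "poly (cpoly f1) z = 0"
    using mset_subset_eqD[OF sub z] f1_0 by simp
  show ?thesis
  proof (cases "Im z = 0")
    case True
    from real_linear_factor[OF root True] obtain g where g: "f1 = [:- Re z, 1:] * g" .
    have "(Re z)\<^sup>2 = (cmod a)\<^sup>2" using True zmod by (simp add: cmod_power2 flip: zmod)
    hence "f = [:- Re z, 1:] * [:(Re z)\<^sup>2, - (2 * Re a), 1:] * g"
      unfolding f1 g by (simp only: mult_ac)
    thus ?thesis using abs_Re[of a] abs_Re[OF zmod] by (intro in_families_cubicI) auto
  next
    case False
    from real_quadratic_factor[OF root False] obtain g
      where g: "f1 = [:(cmod z)\<^sup>2, - (2 * Re z), 1:] * g" .
    have "f = [:(cmod a)\<^sup>2, - (2 * Re a), 1:] * [:(cmod a)\<^sup>2, - (2 * Re z), 1:] * g"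
      unfolding f1 g zmod by (simp only: mult_ac)
    thus ?thesis by (rule in_families_quarticI[OF sq abs_Re[OF refl] abs_Re[OF zmod]])
  qed
qed

text \<open>Real numbers of equal modulus take at most two values, so two of the three roots
  coincide. Their factor \<open>(X - y)\<^sup>2\<close> has constant term
  \<open>y\<^sup>2 = x\<^sup>2\<close>, where \<open>x\<close> is the third root, as the cubic
  family requires.\<close>

lemma equimodular_roots_real:
  assumes f: "f \<noteq> 0" and roots: "{#a, b, c#} \<subseteq># proots (cpoly f)"
    and mod: "cmod b = cmod a" "cmod c = cmod a" and R: "cmod a \<le> R"
    and im: "Im a = 0" "Im b = 0" "Im c = 0"
  shows "in_families R f"
proof -
  \<comment> \<open>Removing one linear factor removes one copy of the root from the multiset, so
    repeated roots yield repeated factors.\<close>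
  have peel: "\<exists>q. h = [:- Re z, 1:] * q \<and> q \<noteq> 0 \<and> X \<subseteq># proots (cpoly q)"
    if "add_mset z X \<subseteq># proots (cpoly h)" "h \<noteq> 0" "Im z = 0" for z h X
  proof -
    have "poly (cpoly h) z = 0" using root_if_subset_proots[OF that(1)] that(2) by simp
    from real_linear_factor[OF this that(3)] obtain q where q: "h = [:- Re z, 1:] * q" .
    have q0: "q \<noteq> 0" using q that(2) by auto
    have "cpoly [:- Re z, 1:] = [:- z, 1:]"
      using that(3) by (simp add: map_poly_pCons complex_eq_iff)
    hence "cpoly h = [:- z, 1:] * cpoly q" unfolding q by (simp only: cpoly_mult)
    hence "proots (cpoly h) = add_mset z (proots (cpoly q))"
      using q0 by (simp add: proots_mult del: mult_pCons_left)
    thus ?thesis using q q0 that(1) by auto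
  qed
  obtain f1 where f1: "f = [:- Re a, 1:] * f1" "f1 \<noteq> 0" "{#b, c#} \<subseteq># proots (cpoly f1)"
    using peel[OF roots f im(1)] by auto
  obtain f2 where f2: "f1 = [:- Re b, 1:] * f2" "f2 \<noteq> 0" "{#c#} \<subseteq># proots (cpoly f2)"
    using peel[OF f1(3,2) im(2)] by auto
  obtain g where g: "f2 = [:- Re c, 1:] * g"
    using peel[OF f2(3,2) im(3)] by auto
  have f_eq: "f = [:- Re a, 1:] * [:- Re b, 1:] * [:- Re c, 1:] * g"
    unfolding f1(1) f2(1) g by (simp only: mult_ac)
  have abs_eq: "\<bar>Re a\<bar> = cmod a" "\<bar>Re b\<bar> = cmod a" "\<bar>Re c\<bar> = cmod a"
    using im mod by (metis cmod_eq_Re)+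
  have *: "in_families R f"
    if "f = [:- x, 1:] * [:- y, 1:] * [:- y, 1:] * g" "\<bar>x\<bar> = cmod a" "\<bar>y\<bar> = cmod a" for x y
  proof (rule in_families_cubicI)
    have "x\<^sup>2 = y\<^sup>2" using that(2,3) by (metis power2_abs)
    hence "[:- y, 1:] * [:- y, 1:] = [:x\<^sup>2, - (2 * y), 1:]" by (simp add: power2_eq_square)
    thus "f = [:- x, 1:] * [:x\<^sup>2, - (2 * y), 1:] * g"
      using that(1) by (metis mult.assoc)
  qed (use that R in auto)
  consider "Re b = Re c" | "Re a = Re c" | "Re a = Re b"
    using abs_eq by (auto simp: abs_if split: if_splits)
  thus ?thesis
  proof cases
    case 1
    show ?thesis by (rule *[of "Re a" "Re b"]) (use f_eq 1 abs_eq in \<open>simp_all only: mult_ac\<close>)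
  next
    case 2
    show ?thesis by (rule *[of "Re b" "Re a"]) (use f_eq 2 abs_eq in \<open>simp_all only: mult_ac\<close>)
  next
    case 3
    show ?thesis by (rule *[of "Re c" "Re a"]) (use f_eq 3 abs_eq in \<open>simp_all only: mult_ac\<close>)
  qed
qed

text \<open>The hypotheses are symmetric in the three roots, so any nonreal one may be listed
  first.\<close>

lemma equimodular_roots_in_families:
  assumes "f \<noteq> 0" "{#a, b, c#} \<subseteq># proots (cpoly f)"
    "cmod b = cmod a" "cmod c = cmod a" "cmod a \<le> R"
  shows "in_families R f"
proof -
  have "{#b, a, c#} = {#a, b, c#}" "{#c, a, b#} = {#a, b, c#}" by simp_all
  thus ?thesis
    using equimodular_roots_nonreal[of f a b c R] equimodular_roots_nonreal[of f b a c R]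
      equimodular_roots_nonreal[of f c a b R] equimodular_roots_real[of f a b c R] assms by metis
qed

section \<open>Bounds for roots and for coefficients of cofactors\<close>

text \<open>A Cauchy-type bound: if \<open>norm z > 1\<close>, the leading term balances
  \<open>n\<close> lower terms, each at most \<open>H * norm z ^ (n - 1)\<close>. Division by that
  power bounds \<open>norm z\<close> by \<open>n / \<epsilon>\<close>, independently of
  \<open>H\<close>.\<close>

lemma norm_root_le:
  fixes F :: "complex poly"
  assumes root: "poly F z = 0" and co: "\<And>j. norm (coeff F j) \<le> H"
    and lead: "\<epsilon> * H \<le> norm (lead_coeff F)" and pos: "0 < \<epsilon>" "0 < H"
  shows "norm z \<le> 1 + real (degree F) / \<epsilon>"
proof (cases "norm z \<le> 1")
  case True
  have "0 \<le> real (degree F) / \<epsilon>" using pos by simp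
  thus ?thesis using True by linarith
next
  case False
  define n where "n = degree F"
  have "n \<noteq> 0"
  proof
    assume "n = 0"
    then obtain c where c: "F = [:c:]" using n_def degree_eq_zeroE by metis
    hence "\<epsilon> * H \<le> 0" using root lead by simp
    thus False using pos by (simp add: mult_le_0_iff)
  qed
  then obtain m where m: "n = Suc m" by (cases n) auto
  have "(\<Sum>i\<le>n. coeff F i * z ^ i) = 0" using root by (simp add: poly_altdef n_def)
  hence "lead_coeff F * z ^ n = - (\<Sum>i\<le>m. coeff F i * z ^ i)"
    by (simp add: m n_def[symmetric] eq_neg_iff_add_eq_0 add.commute)
  hence "norm (lead_coeff F) * norm z ^ n = norm (\<Sum>i\<le>m. coeff F i * z ^ i)"
    by (metis norm_minus_cancel norm_mult norm_power)
  also have "\<dots> \<le> (\<Sum>i\<le>m. H * norm z ^ m)"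
    unfolding norm_mult norm_power using False pos
    by (intro sum_norm_le) (auto simp: norm_mult norm_power intro!: mult_mono co power_increasing)
  also have "\<dots> = real n * H * norm z ^ m" by (simp add: m)
  finally have "norm (lead_coeff F) * norm z * norm z ^ m \<le> real n * H * norm z ^ m"
    by (simp add: m mult.assoc)
  moreover have "0 < norm z ^ m" using False by (intro zero_less_power) linarith
  ultimately have "norm (lead_coeff F) * norm z \<le> real n * H" by simp
  moreover have "\<epsilon> * H * norm z \<le> norm (lead_coeff F) * norm z"
    using lead by (intro mult_right_mono) auto
  ultimately have "H * (\<epsilon> * norm z) \<le> H * real n" by (simp add: mult_ac)
  hence "\<epsilon> * norm z \<le> real n" using pos by simp
  thus ?thesis using pos by (simp add: n_def field_simps)
qed

text \<open>Each coefficient of the product with \<open>[:- x, 1:]\<close> combines two old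
  coefficients with weights \<open>- x\<close> and 1, so every factor enlarges the bound by at most
  \<open>1 + R\<close>.\<close>

lemma norm_coeff_prod_linear_le:
  assumes "\<And>x. x \<in># A \<Longrightarrow> norm x \<le> R" "0 \<le> R"
  shows "norm (coeff (\<Prod>x\<in>#A. [:- x, 1 :: complex:]) j) \<le> (1 + R) ^ size A"
  using assms(1)
proof (induction A arbitrary: j)
  case empty
  show ?case by (simp add: coeff_eq_0 one_pCons coeff_pCons split: nat.split)
next
  case (add x A)
  let ?q = "\<Prod>x\<in>#A. [:- x, 1 :: complex:]"
  have IH: "norm (coeff ?q i) \<le> (1 + R) ^ size A" for i using add by simp
  have "coeff (\<Prod>x\<in>#add_mset x A. [:- x, 1:]) j = - x * coeff ?q j + coeff (pCons 0 ?q) j"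
    by simp
  also have "norm \<dots> \<le> norm (- x * coeff ?q j) + norm (coeff (pCons 0 ?q) j)"
    by (rule norm_triangle_ineq)
  also have "\<dots> \<le> R * (1 + R) ^ size A + (1 + R) ^ size A"
  proof (rule add_mono)
    show "norm (- x * coeff ?q j) \<le> R * (1 + R) ^ size A"
      unfolding norm_mult by (intro mult_mono IH) (use add.prems assms(2) in auto)
    show "norm (coeff (pCons 0 ?q) j) \<le> (1 + R) ^ size A"
      using IH assms(2) by (auto simp: coeff_pCons split: nat.split)
  qed
  finally show ?case by (simp add: algebra_simps)
qed

text \<open>Intended for a cofactor, which inherits the root bound from the whole polynomial; its
  coefficients are then controlled by its leading one.\<close>

lemma norm_coeff_le_roots:
  fixes F :: "complex poly"
  assumes "F \<noteq> 0" "\<And>z. poly F z = 0 \<Longrightarrow> norm z \<le> R" "0 \<le> R"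
  shows "norm (coeff F j) \<le> norm (lead_coeff F) * (1 + R) ^ degree F"
proof -
  have "coeff F j = lead_coeff F * coeff (\<Prod>x\<in>#proots F. [:- x, 1:]) j"
    by (subst complex_poly_decompose_multiset[of F, symmetric]) simp
  moreover have "norm (coeff (\<Prod>x\<in>#proots F. [:- x, 1:]) j) \<le> (1 + R) ^ degree F"
    using norm_coeff_prod_linear_le[of "proots F" R j] assms by (simp add: size_proots_complex)
  ultimately show ?thesis by (simp add: norm_mult mult_left_mono)
qed

text \<open>Multiset inclusion respects multiplicities, so a multiple root may supply several of the
  three. Their common modulus may be any, not only the maximal one.\<close>

definition three_equimodular_roots :: "complex poly \<Rightarrow> bool" where
  "three_equimodular_roots F \<longleftrightarrow>
     (\<exists>a b c. {#a, b, c#} \<subseteq># proots F \<and> norm b = norm a \<and> norm c = norm a)"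

text \<open>The lower bound on the leading coefficient confines all roots to a disc of radius
  \<open>R\<close> that does not depend on \<open>H\<close>. Hence the parameters of both families
  lie in fixed boxes and the general count applies.\<close>

lemma card_three_equimodular_roots_large_lead:
  assumes \<epsilon>: "0 < \<epsilon>"
  shows "\<exists>K. \<forall>H\<ge>1. card {f :: int poly. degree f = n \<and> (\<forall>j\<le>n. \<bar>coeff f j\<bar> \<le> int H) \<and>
    \<epsilon> * real H \<le> real_of_int \<bar>lead_coeff f\<bar> \<and>
    three_equimodular_roots (map_poly of_int f)} \<le> K * H ^ n"
proof -
  define R where "R = 1 + real n / \<epsilon>"
  define B where "B = nat \<lceil>2 * R + R\<^sup>2\<rceil>"
  define C where "C = nat \<lceil>(1 + R) ^ n\<rceil>"
  have R: "0 \<le> R" using \<epsilon> by (simp add: R_def)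
  have box_B: "\<theta> \<in> box d (real B)" if "\<theta> \<in> box d (2 * R + R\<^sup>2)" for \<theta> d
    using that unfolding box_def B_def by (auto intro: order_trans[OF _ real_nat_ceiling_ge])
  obtain K1 where K1: "\<forall>H\<ge>1. \<forall>S. (\<forall>f\<in>S. has_factor_in n 2 B (C * H) cubic_family f) \<longrightarrow>
      card S \<le> K1 * H ^ n"
    using card_parametrized_factor[OF lip_families(1)] ..
  obtain K2 where K2: "\<forall>H\<ge>1. \<forall>S. (\<forall>f\<in>S. has_factor_in n 3 B (C * H) quartic_family f) \<longrightarrow>
      card S \<le> K2 * H ^ n"
    using card_parametrized_factor[OF lip_families(2)] ..
  have "card {f :: int poly. degree f = n \<and> (\<forall>j\<le>n. \<bar>coeff f j\<bar> \<le> int H) \<and>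
    \<epsilon> * real H \<le> real_of_int \<bar>lead_coeff f\<bar> \<and>
    three_equimodular_roots (map_poly of_int f)} \<le> (K1 + K2) * H ^ n" (is "card ?S \<le> _")
    if H: "H \<ge> 1" for H
  proof -
    have "has_factor_in n 2 B (C * H) cubic_family f \<or> has_factor_in n 3 B (C * H) quartic_family f" if f: "f \<in> ?S" for f
    proof -
      let ?f = "map_poly real_of_int f"
      have deg: "degree f = n" using f by simp
      have co: "\<bar>coeff f j\<bar> \<le> int H" for j
        using f by (cases "j \<le> n") (auto simp: coeff_eq_0)
      have cf: "cpoly ?f = map_poly of_int f" by (simp add: map_poly_map_poly o_def)
      have "real_of_int \<bar>lead_coeff f\<bar> > 0"
      proof -
        have "0 < \<epsilon> * real H" using \<epsilon> H by simp
        thus ?thesis using f by auto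
      qed
      hence f0: "?f \<noteq> 0" by (auto simp: poly_eq_iff coeff_map_poly)
      have bound: "cmod z \<le> R" if "poly (cpoly ?f) z = 0" for z
      proof -
        have "cmod z \<le> 1 + real (degree (cpoly ?f)) / \<epsilon>"
        proof (rule norm_root_le[OF that _ _ \<epsilon>, of "real H"])
          show "norm (coeff (cpoly ?f) j) \<le> real H" for j
            using co[of j] by (simp add: coeff_map_poly)
          show "\<epsilon> * real H \<le> cmod (lead_coeff (cpoly ?f))"
            using f deg by (simp add: coeff_map_poly degree_map_poly)
        qed (use H in auto)
        thus ?thesis by (simp add: R_def degree_map_poly deg)
      qed
      obtain a b c where abc: "{#a, b, c#} \<subseteq># proots (cpoly ?f)" "cmod b = cmod a" "cmod c = cmod a"
        using f unfolding three_equimodular_roots_def cf by auto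
      have "cmod a \<le> R"
        using bound root_if_subset_proots[OF abc(1)] f0 by simp
      from equimodular_roots_in_families[OF f0 abc this] have fam: "in_families R ?f" .
      \<comment> \<open>Because \<open>P \<theta>\<close> is monic, \<open>g\<close> has the leading
        coefficient of \<open>f\<close>, at most \<open>H\<close> in modulus. Its roots are roots of
        \<open>f\<close>, so its coefficients are at most \<open>H * (1 + R) ^ n\<close>, which
        explains the choice of \<open>C\<close>.\<close>
      have in_X: "has_factor_in n d B (C * H) P f"
        if "\<theta> \<in> box d (2 * R + R\<^sup>2)" "?f = P \<theta> * g" "lead_coeff (P \<theta>) = 1" "degree (P \<theta>) = Suc d"
        for P \<theta> g d
      proof -
        have g0: "g \<noteq> 0" "P \<theta> \<noteq> 0" using that(2) f0 by auto
        have "degree ?f = Suc d + degree g" using that(2,4) g0 by (simp add: degree_mult_eq)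
        hence dg: "n = Suc d + degree g" by (simp add: degree_map_poly deg)
        have "lead_coeff ?f = lead_coeff g" unfolding that(2) lead_coeff_mult that(3) by simp
        hence lg: "\<bar>lead_coeff g\<bar> \<le> real H"
          using co[of n] by (simp add: coeff_map_poly degree_map_poly deg)
        have "\<bar>coeff g j\<bar> \<le> real (C * H)" for j
        proof -
          have "norm (coeff (cpoly g) j) \<le> norm (lead_coeff (cpoly g)) * (1 + R) ^ degree (cpoly g)"
          proof (rule norm_coeff_le_roots)
            show "cmod z \<le> R" if "poly (cpoly g) z = 0" for z
              using bound[of z] that \<open>?f = P \<theta> * g\<close> by (simp add: cpoly_mult)
          qed (use g0 R in auto)
          hence "\<bar>coeff g j\<bar> \<le> \<bar>lead_coeff g\<bar> * (1 + R) ^ degree g"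
            by (simp add: coeff_map_poly)
          also have "\<dots> \<le> real H * (1 + R) ^ n"
            using R dg by (intro mult_mono lg power_increasing) auto
          also have "\<dots> \<le> real H * real C"
            unfolding C_def by (intro mult_left_mono real_nat_ceiling_ge) auto
          finally show ?thesis by (simp add: mult.commute)
        qed
        moreover have "degree g < n - d" using dg by simp
        ultimately show ?thesis
          unfolding has_factor_in_def using that(2) box_B[OF that(1)] deg by blast
      qed
      have "degree (cubic_family \<theta>) = Suc 2" "degree (quartic_family \<theta>) = Suc 3" for \<theta>
        by (simp_all add: degree_cubic_family degree_quartic_family)
      with fam show ?thesis
        unfolding in_families_def by (blast intro: in_X monic_families)
    qed
    hence "?S = {f \<in> ?S. has_factor_in n 2 B (C * H) cubic_family f} \<union> {f \<in> ?S. has_factor_in n 3 B (C * H) quartic_family f}" by blast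
    hence "card ?S \<le> card {f \<in> ?S. has_factor_in n 2 B (C * H) cubic_family f} + card {f \<in> ?S. has_factor_in n 3 B (C * H) quartic_family f}"
      by (metis (no_types, lifting) card_Un_le)
    also have "\<dots> \<le> K1 * H ^ n + K2 * H ^ n" 
      by (intro add_mono K1[rule_format, OF H] K2[rule_format, OF H]) auto
    also have "\<dots> = (K1 + K2) * H ^ n" by (simp add: algebra_simps)
    finally show ?thesis .
  qed
  thus ?thesis by blast
qed

subsection \<open>Almost all polynomials have one or two roots of maximal modulus\<close>

lemma sorted_norm_list_exists:
  fixes A :: "complex multiset"
  obtains \<alpha> where "mset \<alpha> = A" "sorted_wrt (\<lambda>x y. norm x \<ge> norm y) \<alpha>"
proof -
  obtain xs where xs: "mset xs = A" using ex_mset by blast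
  show ?thesis
  proof (rule that)
    show "mset (sort_key (\<lambda>x. - norm x) xs) = A" using xs by simp
    have "sorted (map (\<lambda>x. - norm x) (sort_key (\<lambda>x. - norm x) xs))" by simp
    thus "sorted_wrt (\<lambda>x y. norm x \<ge> norm y) (sort_key (\<lambda>x. - norm x) xs)"
      by (simp add: sorted_wrt_map)
  qed
qed

text \<open>A multiset of moduli has only one sorted arrangement, so statements about moduli do not
  depend on how ties are ordered.\<close>

lemma map_norm_eq_if_sorted:
  fixes \<alpha> \<beta> :: "complex list"
  assumes "mset \<alpha> = mset \<beta>" "sorted_wrt (\<lambda>x y. norm x \<ge> norm y) \<alpha>"
    "sorted_wrt (\<lambda>x y. norm x \<ge> norm y) \<beta>"
  shows "map norm \<alpha> = map norm \<beta>"
proof -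
  have "sorted (rev (map norm \<alpha>))" "sorted (rev (map norm \<beta>))"
    using assms(2,3) by (simp_all add: sorted_wrt_rev sorted_wrt_map)
  moreover have "mset (rev (map norm \<alpha>)) = mset (rev (map norm \<beta>))" using assms(1) by simp
  ultimately have "rev (map norm \<alpha>) = rev (map norm \<beta>)"
    by (metis properties_for_sort sorted_sort_id)
  thus ?thesis by simp
qed

text \<open>This makes the sets counted by \<open>A_star n 1\<close> and \<open>A_star n 2\<close>
  disjoint, so that their sum counts a union.\<close>

lemma max_modulus_count_unique_1_2:
  assumes "degree F \<ge> 2" "has_exactly_max_modulus_roots 1 F"
  shows "\<not> has_exactly_max_modulus_roots 2 F"
proof
  assume "has_exactly_max_modulus_roots 2 F"
  then obtain \<beta> where b: "mset \<beta> = proots F" "sorted_wrt (\<lambda>x y. norm x \<ge> norm y) \<beta>"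
      "\<forall>i<2. norm (\<beta> ! i) = norm (\<beta> ! 0)"
    unfolding has_exactly_max_modulus_roots_def by blast
  \<comment> \<open>As the degree is at least 2, the alternative \<open>k = degree F\<close> is
    excluded for \<open>k = 1\<close> and the strict drop remains.\<close>
  obtain \<alpha> where a: "mset \<alpha> = proots F" "sorted_wrt (\<lambda>x y. norm x \<ge> norm y) \<alpha>"
      "norm (\<alpha> ! 0) > norm (\<alpha> ! 1)"
    using assms unfolding has_exactly_max_modulus_roots_def by auto
  have len: "length \<alpha> \<ge> 2" "length \<beta> \<ge> 2"
    using assms(1) size_proots_complex[of F] arg_cong[OF a(1), of size] arg_cong[OF b(1), of size]
    by simp_all
  have "map norm \<alpha> = map norm \<beta>" using a b by (intro map_norm_eq_if_sorted) auto
  hence "norm (\<alpha> ! i) = norm (\<beta> ! i)" if "i < 2" for i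
    using len that nth_map[of i \<alpha> norm] nth_map[of i \<beta> norm] by (simp del: nth_map)
  note eq = this
  from eq[of 0] eq[of 1] b(3)[rule_format, of 1] show False using a(3) by linarith
qed

text \<open>In a list sorted by modulus, failure for 1 makes the first two moduli equal; failure for
  2 then excludes degree 2 and makes the third modulus equal as well.\<close>

lemma three_equimodular_roots_if_not_1_2:
  assumes deg: "degree F \<ge> 2" and no: "\<not> has_exactly_max_modulus_roots 1 F"
    "\<not> has_exactly_max_modulus_roots 2 F"
  shows "three_equimodular_roots F"
proof -
  obtain \<alpha> where a: "mset \<alpha> = proots F" "sorted_wrt (\<lambda>x y. norm x \<ge> norm y) \<alpha>"
    by (rule sorted_norm_list_exists)
  have len: "length \<alpha> = degree F" using size_proots_complex[of F] arg_cong[OF a(1), of size] by simp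
  have le: "norm (\<alpha> ! j) \<le> norm (\<alpha> ! i)" if "i < j" "j < degree F" for i j
    using a(2) that len by (simp add: sorted_wrt_iff_nth_less)
  have intro: "has_exactly_max_modulus_roots k F"
    if "1 \<le> k" "k \<le> degree F" "\<forall>i<k. norm (\<alpha> ! i) = norm (\<alpha> ! 0)"
      "k = degree F \<or> norm (\<alpha> ! (k - 1)) > norm (\<alpha> ! k)" for k
    unfolding has_exactly_max_modulus_roots_def using that a by blast
  have "\<not> norm (\<alpha> ! 1) < norm (\<alpha> ! 0)"
    using no(1) intro[of 1] deg by auto
  hence 1: "norm (\<alpha> ! 1) = norm (\<alpha> ! 0)" using le[of 0 1] deg by auto
  hence *: "\<forall>i<2. norm (\<alpha> ! i) = norm (\<alpha> ! 0)" by (metis One_nat_def less_2_cases)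
  have "\<not> (2 = degree F \<or> norm (\<alpha> ! (2 - 1)) > norm (\<alpha> ! 2))"
    using no(2) intro[OF _ deg *] by linarith
  hence "degree F \<noteq> 2" "\<not> norm (\<alpha> ! 2) < norm (\<alpha> ! 1)" by auto
  hence 2: "norm (\<alpha> ! 2) = norm (\<alpha> ! 0)" "length \<alpha> \<ge> 3" using le[of 1 2] deg 1 len by auto
  then obtain x y z xs where "\<alpha> = x # y # z # xs"
    by (metis Suc_le_length_iff numeral_3_eq_3)
  hence "{#x, y, z#} \<subseteq># proots F" "norm y = norm x" "norm z = norm x"
    using a(1) 1 2(1) by (auto simp flip: a(1) simp: numeral_2_eq_2)
  thus ?thesis unfolding three_equimodular_roots_def by blast
qed

section \<open>Counting by the leading coefficient\<close>

lemma height_le_iff: "height f \<le> int H \<longleftrightarrow> (\<forall>j\<le>degree f. \<bar>coeff f j\<bar> \<le> int H)"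
  unfolding height_def by (subst Max_le_iff) auto

lemma card_nonzero_lead:
  assumes "n \<ge> 1"
  shows "card {f :: int poly. degree f = n \<and> height f \<le> int H} = 2 * H * (2 * H + 1) ^ n"
    and "finite {f :: int poly. degree f = n \<and> height f \<le> int H}"
proof -
  let ?A = "\<lambda>j. if j = n then {- int H..int H} - {0} else {- int H..int H}"
  have eq: "{f :: int poly. degree f = n \<and> height f \<le> int H} =
      {f. degree f \<le> n \<and> (\<forall>j\<le>n. coeff f j \<in> ?A j)}"
  proof (intro Collect_cong iffI)
    fix f :: "int poly"
    assume f: "degree f = n \<and> height f \<le> int H"
    \<comment> \<open>The zero polynomial has degree 0 and is ruled out by
      \<open>n \<ge> 1\<close>.\<close>
    hence "coeff f n \<noteq> 0" using assms by auto
    thus "degree f \<le> n \<and> (\<forall>j\<le>n. coeff f j \<in> ?A j)"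
      using f unfolding height_le_iff by (auto simp: abs_le_iff minus_le_iff)
  next
    fix f :: "int poly"
    assume f: "degree f \<le> n \<and> (\<forall>j\<le>n. coeff f j \<in> ?A j)"
    hence "coeff f n \<in> ?A n" by blast
    hence "coeff f n \<noteq> 0" by simp
    hence deg: "degree f = n" using f le_degree by (metis antisym)
    have "\<bar>coeff f j\<bar> \<le> int H" if "j \<le> n" for j
    proof -
      have "coeff f j \<in> ?A j" using f that by blast
      hence "coeff f j \<in> {- int H..int H}" by (metis DiffD1)
      thus ?thesis by auto
    qed
    thus "degree f = n \<and> height f \<le> int H" unfolding height_le_iff using deg by blast
  qed
  have "card ({- int H..int H} - {0}) = 2 * H" by (subst card_Diff_singleton) auto
  moreover have "nat (2 * int H + 1) = 2 * H + 1" by linarith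
  ultimately show "card {f :: int poly. degree f = n \<and> height f \<le> int H} = 2 * H * (2 * H + 1) ^ n"
    unfolding eq card_coeff_box by (simp flip: lessThan_Suc_atMost)
  show "finite {f :: int poly. degree f = n \<and> height f \<le> int H}"
    unfolding eq by (intro finite_coeff_box) auto
qed

text \<open>The leading coefficient has at most \<open>2 * \<delta> + 1\<close> values. Zero may be
  included among them since only an upper bound is wanted.\<close>

lemma card_small_lead:
  assumes "0 \<le> \<delta>"
  shows "card {f :: int poly. degree f = n \<and> height f \<le> int H \<and> real_of_int \<bar>lead_coeff f\<bar> \<le> \<delta>}
     \<le> (2 * \<delta> + 1) * real ((2 * H + 1) ^ n)"
proof -
  define m where "m = nat \<lfloor>\<delta>\<rfloor>"
  let ?A = "\<lambda>j. if j = n then {- int m..int m} else {- int H..int H}"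
  let ?X = "{f. degree f \<le> n \<and> (\<forall>j\<le>n. coeff f j \<in> ?A j)}"
  have m: "- int m \<le> x \<and> x \<le> int m" if "real_of_int \<bar>x\<bar> \<le> \<delta>" for x
    using that assms unfolding m_def by linarith
  have "{f :: int poly. degree f = n \<and> height f \<le> int H \<and> real_of_int \<bar>lead_coeff f\<bar> \<le> \<delta>} \<subseteq> ?X"
  proof safe
    fix f j assume f: "height f \<le> int H" "real_of_int \<bar>lead_coeff f\<bar> \<le> \<delta>" "j \<le> degree f"
    have "\<bar>coeff f j\<bar> \<le> int H" using f(1,3) unfolding height_le_iff by blast
    thus "coeff f j \<in> (if j = degree f then {- int m..int m} else {- int H..int H})"
      using m[OF f(2)] by auto
  qed
  hence "card {f :: int poly. degree f = n \<and> height f \<le> int H \<and> real_of_int \<bar>lead_coeff f\<bar> \<le> \<delta>}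
      \<le> card ?X" by (intro card_mono finite_coeff_box) auto
  also have "\<dots> = (2 * m + 1) * (2 * H + 1) ^ n"
  proof -
    have "nat (2 * int k + 1) = 2 * k + 1" for k by linarith
    thus ?thesis unfolding card_coeff_box by (simp flip: lessThan_Suc_atMost)
  qed
  also have "real \<dots> = (2 * real m + 1) * real ((2 * H + 1) ^ n)" by (simp add: algebra_simps)
  also have "\<dots> \<le> (2 * \<delta> + 1) * real ((2 * H + 1) ^ n)"
    using assms unfolding m_def by (intro mult_right_mono) auto
  finally show ?thesis by simp
qed

text \<open>Relative to \<open>2 * H * (2 * H + 1) ^ n\<close>, the small leading coefficients cost
  \<open>\<epsilon>\<close> up to a term of order \<open>1 / H\<close>, and the triples of
  equimodular roots cost only order \<open>1 / H\<close>.\<close>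

lemma A_star_bounds:
  assumes n: "n \<ge> 2" and \<epsilon>: "0 < \<epsilon>"
  shows "\<exists>K. \<forall>H\<ge>1. A_star n 1 H + A_star n 2 H \<le> 2 * H * (2 * H + 1) ^ n \<and>
    real (2 * H * (2 * H + 1) ^ n) \<le> real (A_star n 1 H + A_star n 2 H) +
      (2 * \<epsilon> * real H + 1) * (2 * real H + 1) ^ n + real (K * H ^ n)"
proof -
  obtain K where K: "\<forall>H\<ge>1. card {f :: int poly. degree f = n \<and> (\<forall>j\<le>n. \<bar>coeff f j\<bar> \<le> int H) \<and>
    \<epsilon> * real H \<le> real_of_int \<bar>lead_coeff f\<bar> \<and>
    three_equimodular_roots (map_poly of_int f)} \<le> K * H ^ n"
    using card_three_equimodular_roots_large_lead[OF \<epsilon>] ..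
  show ?thesis
  proof (intro exI allI impI)
    fix H :: nat assume H: "H \<ge> 1"
    let ?T = "{f :: int poly. degree f = n \<and> height f \<le> int H}"
    let ?G = "\<lambda>k. {f :: int poly. degree f = n \<and> height f \<le> int H \<and>
       has_exactly_max_modulus_roots k (map_poly of_int f)}"
    let ?S = "{f :: int poly. degree f = n \<and> height f \<le> int H \<and>
       real_of_int \<bar>lead_coeff f\<bar> \<le> \<epsilon> * real H}"
    let ?L = "{f :: int poly. degree f = n \<and> (\<forall>j\<le>n. \<bar>coeff f j\<bar> \<le> int H) \<and>
       \<epsilon> * real H \<le> real_of_int \<bar>lead_coeff f\<bar> \<and> three_equimodular_roots (map_poly of_int f)}"
    have T: "card ?T = 2 * H * (2 * H + 1) ^ n" "finite ?T"
      using card_nonzero_lead[of n H] n by auto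
    have deg: "degree (map_poly complex_of_int f) = degree f" for f
      by (simp add: degree_map_poly)
    have "?G 1 \<inter> ?G 2 = {}" using max_modulus_count_unique_1_2 n deg by fastforce
    hence A: "A_star n 1 H + A_star n 2 H = card (?G 1 \<union> ?G 2)"
      unfolding A_star_def using T(2)
      by (intro card_Un_disjoint[symmetric]) (auto elim!: finite_subset[rotated])
    have "card (?G 1 \<union> ?G 2) \<le> card ?T" using T(2) by (intro card_mono) auto
    hence upper: "A_star n 1 H + A_star n 2 H \<le> 2 * H * (2 * H + 1) ^ n" using A T(1) by simp
    \<comment> \<open>A polynomial outside \<open>?G 1\<close> and \<open>?G 2\<close> has three
      equimodular roots, so it lies in \<open>?S\<close> or \<open>?L\<close> according to the size
      of its leading coefficient.\<close>
    have "?T \<subseteq> (?G 1 \<union> ?G 2) \<union> (?S \<union> ?L)"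
      using three_equimodular_roots_if_not_1_2 n deg by (fastforce simp: height_le_iff)
    hence "card ?T \<le> card ((?G 1 \<union> ?G 2) \<union> (?S \<union> ?L))"
      using T(2) by (intro card_mono) (auto simp: height_le_iff elim!: finite_subset[rotated])
    also have "\<dots> \<le> card (?G 1 \<union> ?G 2) + (card ?S + card ?L)"
      by (meson add_mono card_Un_le order_refl order_trans)
    finally have "2 * H * (2 * H + 1) ^ n \<le> (A_star n 1 H + A_star n 2 H) + (card ?S + card ?L)"
      using A T(1) by simp
    hence "real (2 * H * (2 * H + 1) ^ n) \<le> real ((A_star n 1 H + A_star n 2 H) + (card ?S + card ?L))"
      by (rule of_nat_mono)
    moreover have "real (card ?S) \<le> (2 * \<epsilon> * real H + 1) * (2 * real H + 1) ^ n"
      using card_small_lead[of "\<epsilon> * real H" n H] \<epsilon> by (simp add: mult.assoc add.commute)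
    moreover have "real (card ?L) \<le> real (K * H ^ n)"
      using K H by (intro of_nat_mono) blast
    ultimately have "real (2 * H * (2 * H + 1) ^ n) \<le> real (A_star n 1 H + A_star n 2 H) +
      (2 * \<epsilon> * real H + 1) * (2 * real H + 1) ^ n + real (K * H ^ n)"
      by (simp only: of_nat_add)
    with upper show "A_star n 1 H + A_star n 2 H \<le> 2 * H * (2 * H + 1) ^ n \<and>
      real (2 * H * (2 * H + 1) ^ n) \<le> real (A_star n 1 H + A_star n 2 H) +
        (2 * \<epsilon> * real H + 1) * (2 * real H + 1) ^ n + real (K * H ^ n)" ..
  qed
qed

section \<open>Convergence of the proportion to 1\<close>

theorem theorem1p1:
  fixes n :: nat
  assumes "n \<ge> 2"
  shows "(\<lambda>H :: nat. (real (A_star n 1 H) + real (A_star n 2 H)) /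
           (2 * real H * (2 * real H + 1) ^ n)) \<longlonglongrightarrow> 1"
proof (rule LIMSEQ_I)
  fix r :: real assume r: "0 < r"
  \<comment> \<open>With \<open>\<epsilon> = r / 2\<close> the small leading coefficients use up
    half of the permitted error \<open>r * (2 * H * Q)\<close>, with \<open>Q\<close> as defined
    below.\<close>
  obtain K where K: "\<forall>H\<ge>1. A_star n 1 H + A_star n 2 H \<le> 2 * H * (2 * H + 1) ^ n \<and>
    real (2 * H * (2 * H + 1) ^ n) \<le> real (A_star n 1 H + A_star n 2 H) +
      (2 * (r / 2) * real H + 1) * (2 * real H + 1) ^ n + real (K * H ^ n)"
    using A_star_bounds[OF assms, of "r / 2"] r by auto
  \<comment> \<open>The other half, \<open>r * H * Q\<close>, has to absorb
    \<open>(1 + K) * Q\<close>, hence the threshold \<open>(1 + K) / r\<close>. The added 1 secures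
    strictness and \<open>H \<ge> 1\<close>.\<close>
  define N where "N = nat \<lceil>(1 + real K) / r\<rceil> + 1"
  show "\<exists>N. \<forall>H\<ge>N. norm ((real (A_star n 1 H) + real (A_star n 2 H)) /
           (2 * real H * (2 * real H + 1) ^ n) - 1) < r"
  proof (intro exI allI impI)
    fix H assume "N \<le> H"
    hence H: "H \<ge> 1" "(1 + real K) / r < real H" unfolding N_def by linarith+
    define Q where "Q = (2 * real H + 1) ^ n"
    define A where "A = real (A_star n 1 H) + real (A_star n 2 H)"
    have Q: "Q > 0" "real H ^ n \<le> Q" unfolding Q_def by (auto intro: power_mono)
    have "real (A_star n 1 H + A_star n 2 H) \<le> real (2 * H * (2 * H + 1) ^ n)"
      using K H(1) by (intro of_nat_mono) blast
    hence up: "A \<le> 2 * real H * Q" by (simp add: A_def Q_def add.commute)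
    have "real (2 * H * (2 * H + 1) ^ n) \<le> real (A_star n 1 H + A_star n 2 H) +
      (2 * (r / 2) * real H + 1) * (2 * real H + 1) ^ n + real (K * H ^ n)"
      using K H(1) by blast
    hence "2 * real H * Q \<le> A + (r * real H + 1) * Q + real K * real H ^ n"
      by (simp add: A_def Q_def add.commute)
    also have "real K * real H ^ n \<le> real K * Q" using Q by (intro mult_left_mono) auto
    finally have "2 * real H * Q - A \<le> (r * real H + (1 + real K)) * Q"
      by (simp add: algebra_simps)
    also have "1 + real K < r * real H" using H(2) r by (simp add: field_simps)
    hence "(r * real H + (1 + real K)) * Q < (r * real H + r * real H) * Q"
      using Q(1) by (intro mult_strict_right_mono) auto
    finally have low: "2 * real H * Q - A < r * (2 * real H * Q)" by (simp add: algebra_simps)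
    have pos: "0 < 2 * real H * Q" using H(1) Q(1) by simp
    have "A / (2 * real H * Q) - 1 = - ((2 * real H * Q - A) / (2 * real H * Q))"
      using pos by (simp only: diff_divide_distrib divide_self[OF less_imp_neq[OF pos, symmetric]]
          minus_diff_eq)
    hence "norm (A / (2 * real H * Q) - 1) = \<bar>(2 * real H * Q - A) / (2 * real H * Q)\<bar>"
      by (simp only: real_norm_def abs_minus_cancel)
    \<comment> \<open>By \<open>up\<close> the numerator never exceeds the denominator, so the
      deviation from 1 is one-sided and \<open>low\<close> settles it.\<close>
    also have "\<dots> = (2 * real H * Q - A) / (2 * real H * Q)"
      using up pos by (intro abs_of_nonneg divide_nonneg_pos) auto
    also have "\<dots> < r" using low pos by (simp only: pos_divide_less_eq)
    finally show "norm ((real (A_star n 1 H) + real (A_star n 2 H)) /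
           (2 * real H * (2 * real H + 1) ^ n) - 1) < r" unfolding A_def Q_def .
  qed
qed

end
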